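(* Let $r$ be a positive integer and let $\mathbb{M}=(V,\mathcal{C})$ be the rank-$r$ uniform matroid on $n=|V|\ge r$ elements, i.e. $\mathcal{C}=\{C\subseteq V: |C|=r+1\}$. Then the minimum cardinality of a generator of $\mathcal{C}$ is $n-r$.
   Context: For $\mathcal{F}\subseteq 2^V$ and $\mathcal{G}\subseteq\mathcal{F}$, let $\langle\mathcal{G}\rangle^1_{\mathcal{F}}=\mathcal{G}\cup\{X\in\mathcal{F}: X=(X_1\cup X_2)\setminus\{v\}$ for distinct $X_1,X_2\in\mathcal{G}$ and $v\in X_1\cap X_2\}$; iterate until stable to obtain $\langle\mathcal{G}\rangle_{\mathcal{F}}$; $\mathcal{G}$ is a generator of $\mathcal{F}$ if $\langle\mathcal{G}\rangle_{\mathcal{F}}=\mathcal{F}$. *)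

theory Defs
  imports Main
begin

definition gen_step :: "'a set set \<Rightarrow> 'a set set \<Rightarrow> 'a set set" where
  "gen_step \<F> \<G> = \<G> \<union>
     {X \<in> \<F>. \<exists>X1 \<in> \<G>. \<exists>X2 \<in> \<G>. X1 \<noteq> X2 \<and> (\<exists>v \<in> X1 \<inter> X2. X = (X1 \<union> X2) - {v})}"

text \<open>The iterates of \<^const>\<open>gen_step\<close> increase, so for finite \<open>\<F>\<close> and \<open>\<G> \<subseteq> \<F>\<close> the union of
  all iterates is the family at which the iteration becomes stable.\<close>

definition generated :: "'a set set \<Rightarrow> 'a set set \<Rightarrow> 'a set set" where
  "generated \<F> \<G> = (\<Union>k. (gen_step \<F> ^^ k) \<G>)"

definition generator :: "'a set set \<Rightarrow> 'a set set \<Rightarrow> bool" where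
  "generator \<F> \<G> \<longleftrightarrow> \<G> \<subseteq> \<F> \<and> generated \<F> \<G> = \<F>"

definition uniform_circuits :: "'a set \<Rightarrow> nat \<Rightarrow> 'a set set" where
  "uniform_circuits V r = {C. C \<subseteq> V \<and> card C = r + 1}"

end

theory Submission
  imports Defs
begin

text \<open>For the upper bound, fix an \<open>r\<close>-set \<open>S\<close> and take all \<open>S \<union> {x}\<close> with \<open>x \<notin> S\<close>; every other
  circuit \<open>C\<close> is eliminated from two circuits with fewer points outside \<open>S\<close>.

  For the lower bound, cover a generator by sets \<open>A\<close> of size greater than \<open>r\<close>, starting with its own
  members, and merge two sets whenever they share at least \<open>r\<close> points. Merging does not increase
  \<open>\<Sum>A. (|A| - r)\<close>. In the end distinct sets share fewer than \<open>r\<close> points, so an elimination step never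
  leaves a set of the cover; hence every circuit lies in one of them, which forces one to be \<open>V\<close>.\<close>

lemma subset_generated: "\<G> \<subseteq> generated \<F> \<G>"
proof -
  have "(gen_step \<F> ^^ 0) \<G> \<subseteq> generated \<F> \<G>"
    unfolding generated_def by blast
  then show ?thesis by simp
qed

text \<open>The two sets may first appear at different stages. Iterates increase, so both are
  present at the later stage, and one more step eliminates \<open>v\<close>.\<close>

lemma generated_closed:
  assumes "X1 \<in> generated \<F> \<G>" "X2 \<in> generated \<F> \<G>" "X1 \<noteq> X2" "v \<in> X1 \<inter> X2"
    and "(X1 \<union> X2) - {v} \<in> \<F>"
  shows "(X1 \<union> X2) - {v} \<in> generated \<F> \<G>"
proof -
  have mono: "(gen_step \<F> ^^ i) \<G> \<subseteq> (gen_step \<F> ^^ j) \<G>" if "i \<le> j" for i j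
    by (rule lift_Suc_mono_le[OF _ that]) (auto simp: gen_step_def)
  obtain i j where "X1 \<in> (gen_step \<F> ^^ i) \<G>" "X2 \<in> (gen_step \<F> ^^ j) \<G>"
    using assms(1,2) by (auto simp: generated_def)
  then have "X1 \<in> (gen_step \<F> ^^ max i j) \<G>" "X2 \<in> (gen_step \<F> ^^ max i j) \<G>"
    using mono[of i "max i j"] mono[of j "max i j"] by auto
  then have "(X1 \<union> X2) - {v} \<in> (gen_step \<F> ^^ Suc (max i j)) \<G>"
    using assms(3-5) by (auto simp: gen_step_def)
  then show ?thesis
    unfolding generated_def by blast
qed

text \<open>The invariant principle for both bounds: it keeps the star inside the circuits, and
  confines what a generator produces to the sets of a cover.\<close>

lemma generated_least:
  assumes "\<G> \<subseteq> \<Q>" and "gen_step \<F> \<Q> \<subseteq> \<Q>"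
  shows "generated \<F> \<G> \<subseteq> \<Q>"
proof -
  have "(gen_step \<F> ^^ k) \<G> \<subseteq> \<Q>" for k
  proof (induction k)
    case (Suc k)
    then have "gen_step \<F> ((gen_step \<F> ^^ k) \<G>) \<subseteq> gen_step \<F> \<Q>"
      unfolding gen_step_def by blast
    with assms(2) show ?case by simp
  qed (use assms(1) in simp)
  then show ?thesis
    unfolding generated_def by blast
qed

lemma star_generates_uniform_circuits:
  assumes V: "finite V" and S: "S \<subseteq> V" "card S = r"
  shows "generator (uniform_circuits V r) ((\<lambda>x. insert x S) ` (V - S))"
    (is "generator ?F ?G")
proof -
  have finS: "finite S" using V S finite_subset by blast
  have sub: "?G \<subseteq> ?F"
    using S finS by (auto simp: uniform_circuits_def)
  have "C \<in> generated ?F ?G" if "C \<in> ?F" for C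
    using that
  proof (induction "card (C - S)" arbitrary: C rule: less_induct)
    case less
    have C: "C \<subseteq> V" "card C = r + 1" "finite C"
      using less.prems V finite_subset by (auto simp: uniform_circuits_def)
    have sum1: "card (C - S) + card (C \<inter> S) = r + 1"
      using card_Int_Diff[OF C(3), of S] C(2) by simp
    have sum2: "card (S - C) + card (C \<inter> S) = r"
      using card_Int_Diff[OF finS, of C] S(2) by (simp add: Int_commute)
    show ?case
    proof (cases "S \<subseteq> C")
      case True
      then have "card (C - S) = 1"
        using sum1 S by (simp add: Int_absorb1)
      then obtain x where "C - S = {x}"
        by (rule card_1_singletonE)
      then have "C = insert x S" "x \<in> V - S"
        using True C by auto
      then show ?thesis
        using subsetD[OF subset_generated[of ?G ?F], of C] by simp
    next
      case False
      then obtain s where s: "s \<in> S" "s \<notin> C" by blast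
      have "0 < card (S - C)"
        using s finS by (auto simp: card_gt_0_iff)
      \<comment> \<open>\<open>C\<close> has one element more than \<open>S\<close>, so each point
        of \<open>S\<close> that it misses forces an extra point outside \<open>S\<close>.\<close>
      then have "2 \<le> card (C - S)"
        using sum1 sum2 by linarith
      then obtain x y where xy: "x \<in> C - S" "y \<in> C - S" "x \<noteq> y"
        using card_le_Suc0_iff_eq[of "C - S"] C(3) by fastforce
      \<comment> \<open>Exchanging \<open>z\<close> for the missing \<open>s\<close> keeps the size
        and lowers the induction measure by one.\<close>
      have swap: "insert s C - {z} \<in> generated ?F ?G" if z: "z \<in> C - S" for z
      proof (rule less.hyps)
        have "insert s C - {z} - S = (C - S) - {z}"
          using s by auto
        then show "card (insert s C - {z} - S) < card (C - S)"
          using card_Diff1_less[of "C - S" z] C(3) z by simp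
        show "insert s C - {z} \<in> ?F"
          using C s S z by (auto simp: uniform_circuits_def card_insert_if)
      qed
      \<comment> \<open>Each exchanged circuit contains the point that the other lost, and both
        contain \<open>s\<close>, so eliminating \<open>s\<close> gives back
        \<open>C\<close>.\<close>
      have eq: "((insert s C - {x}) \<union> (insert s C - {y})) - {s} = C"
        using s xy by auto
      show ?thesis
        using generated_closed[OF swap[OF xy(1)] swap[OF xy(2)], of s] xy s less.prems
        unfolding eq by blast
    qed
  qed
  moreover have "generated ?F ?G \<subseteq> ?F"
    by (rule generated_least[OF sub]) (auto simp: gen_step_def)
  ultimately show ?thesis
    using sub by (auto simp: generator_def)
qed

text \<open>The weight \<open>card A - r\<close> is the size of a star generating all circuits
  inside \<open>A\<close>; a single circuit weighs 1, so \<G> covers itself within the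
  bound.\<close>

lemma exists_separated_cover:
  fixes r :: nat
  assumes "finite \<G>" and \<G>: "\<And>A. A \<in> \<G> \<Longrightarrow> card A = r + 1"
  obtains P where "finite P" and "\<forall>A\<in>P. A \<subseteq> \<Union>\<G> \<and> r < card A"
    and "\<forall>X\<in>\<G>. \<exists>A\<in>P. X \<subseteq> A" and "(\<Sum>A\<in>P. card A - r) \<le> card \<G>"
    and "\<forall>A\<in>P. \<forall>B\<in>P. r \<le> card (A \<inter> B) \<longrightarrow> A = B"
proof -
  define cover where "cover P \<longleftrightarrow> finite P \<and> (\<forall>A\<in>P. A \<subseteq> \<Union>\<G> \<and> r < card A) \<and>
    (\<forall>X\<in>\<G>. \<exists>A\<in>P. X \<subseteq> A) \<and> (\<Sum>A\<in>P. card A - r) \<le> card \<G>" for P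
  have "cover \<G>"
    using assms by (auto simp: cover_def)
  \<comment> \<open>A cover with the fewest sets stands for the end of the merging process: any
    further merge would contradict minimality.\<close>
  then obtain P where P: "cover P" and min: "\<And>Q. cover Q \<Longrightarrow> card P \<le> card Q"
    using arg_min_nat_lemma[of cover \<G> card] by blast
  have sep: "A = B" if AB: "A \<in> P" "B \<in> P" and int: "r \<le> card (A \<inter> B)" for A B
  proof (rule ccontr)
    assume ne: "A \<noteq> B"
    define Q where "Q = insert (A \<union> B) (P - {A, B})"
    have finP: "finite P" and "r < card A" "r < card B"
      using P AB by (auto simp: cover_def)
    \<comment> \<open>Infinite sets have \<open>card\<close> 0, so exceeding \<open>r\<close> forces
      finiteness.\<close>
    then have fin: "finite A" "finite B"
      by (auto intro: card_ge_0_finite)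
    have cards: "card (A \<union> B) + card (A \<inter> B) = card A + card B"
      using card_Un_Int[OF fin] by simp
    \<comment> \<open>Only an inequality, since \<open>A \<union> B\<close> may already belong to
      \<open>P\<close>.\<close>
    have "(\<Sum>X\<in>Q. card X - r) \<le> (card (A \<union> B) - r) + (\<Sum>X\<in>P - {A, B}. card X - r)"
      using finP by (simp add: Q_def sum.insert_if)
    \<comment> \<open>By inclusion-exclusion this amounts to
      \<open>r \<le> card (A \<inter> B)\<close>; no subtraction truncates, as all three sets have
      more than \<open>r\<close> points.\<close>
    also have "\<dots> \<le> (card A - r) + (card B - r) + (\<Sum>X\<in>P - {A, B}. card X - r)"
      using cards int \<open>r < card A\<close> \<open>r < card B\<close> by linarith
    also have "\<dots> = (\<Sum>X\<in>P. card X - r)"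
      using sum.subset_diff[of "{A, B}" P "\<lambda>X. card X - r"] AB finP ne by simp
    also have "\<dots> \<le> card \<G>"
      using P by (simp add: cover_def)
    finally have "(\<Sum>X\<in>Q. card X - r) \<le> card \<G>" .
    moreover have "\<exists>Y\<in>Q. X \<subseteq> Y" if X: "X \<in> \<G>" for X
    proof -
      obtain Y where "Y \<in> P" "X \<subseteq> Y"
        using P X by (auto simp: cover_def)
      then show ?thesis
        by (cases "Y = A \<or> Y = B") (auto simp: Q_def)
    qed
    moreover have "r < card (A \<union> B)"
      using \<open>r < card A\<close> fin by (meson card_mono finite_UnI less_le_trans Un_upper1)
    ultimately have "cover Q"
      using P AB by (auto simp: cover_def Q_def)
    then have "card P \<le> card Q"
      by (rule min)
    moreover have "card Q \<le> Suc (card (P - {A, B}))"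
      by (simp add: Q_def card_insert_if finP)
    moreover have "card P = card (P - {A, B}) + 2"
      using card_Diff_subset[of "{A, B}" P] card_mono[of P "{A, B}"] AB ne finP by simp
    ultimately show False by linarith
  qed
  show ?thesis
  proof (rule that[of P])
    show "\<forall>A\<in>P. \<forall>B\<in>P. r \<le> card (A \<inter> B) \<longrightarrow> A = B"
      using sep by blast
  qed (use P in \<open>auto simp: cover_def\<close>)
qed

lemma generator_uniform_circuits_card_ge:
  assumes V: "finite V" and gen: "generator (uniform_circuits V r) \<G>"
  shows "card V - r \<le> card \<G>"
\<comment> \<open>Otherwise truncated subtraction makes the bound 0.\<close>
proof (cases "r < card V")
  case True
  let ?F = "uniform_circuits V r"
  have sub: "\<G> \<subseteq> ?F" and eq: "generated ?F \<G> = ?F"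
    using gen by (auto simp: generator_def)
  have "?F \<subseteq> Pow V"
    by (auto simp: uniform_circuits_def)
  with V sub have fin\<G>: "finite \<G>" and \<G>V: "\<Union>\<G> \<subseteq> V"
    by (auto intro: finite_subset)
  have card\<G>: "card A = r + 1" if "A \<in> \<G>" for A
    using that sub by (auto simp: uniform_circuits_def)
  obtain P where finP: "finite P" and P: "\<forall>A\<in>P. A \<subseteq> \<Union>\<G> \<and> r < card A"
    and cov: "\<forall>X\<in>\<G>. \<exists>A\<in>P. X \<subseteq> A" and sum: "(\<Sum>A\<in>P. card A - r) \<le> card \<G>"
    and sep: "\<forall>A\<in>P. \<forall>B\<in>P. r \<le> card (A \<inter> B) \<longrightarrow> A = B"
    using exists_separated_cover[OF fin\<G> card\<G>] by blast
  have PV: "A \<subseteq> \<Union>\<G>" and big: "r < card A" if "A \<in> P" for A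
    using P that by auto
  have finA: "finite A" if "A \<in> P" for A
    using finite_subset[OF subset_trans[OF PV[OF that] \<G>V] V] .
  let ?Q = "{X \<in> ?F. \<exists>A\<in>P. X \<subseteq> A}"
  have "?F \<subseteq> ?Q"
  proof (subst eq[symmetric], rule generated_least)
    show "gen_step ?F ?Q \<subseteq> ?Q"
    proof
      fix X assume "X \<in> gen_step ?F ?Q"
      then consider "X \<in> ?Q" | X1 X2 v where "X \<in> ?F" "X1 \<in> ?Q" "X2 \<in> ?Q" "v \<in> X1 \<inter> X2"
        "X = (X1 \<union> X2) - {v}"
        unfolding gen_step_def by blast
      then show "X \<in> ?Q"
      proof cases
        case 2
        obtain A B where AB: "A \<in> P" "X1 \<subseteq> A" "B \<in> P" "X2 \<subseteq> B"
          using 2 by auto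
        have fin: "finite X1" "finite X2"
          using AB finA finite_subset by blast+
        have c: "card X = r + 1" "card X1 = r + 1" "card X2 = r + 1"
          using 2 by (auto simp: uniform_circuits_def)
        have "card X = card (X1 \<union> X2) - 1"
          using 2 fin by (simp add: card_Diff_singleton)
        \<comment> \<open>Removing \<open>v\<close> leaves \<open>r + 1\<close> points, so the union
          has \<open>r + 2\<close> and the intersection \<open>2(r + 1) - (r + 2) = r\<close>, just
          enough for separation to identify \<open>A\<close> and \<open>B\<close>.\<close>
        then have "card (X1 \<inter> X2) = r"
          using card_Un_Int[OF fin] c by linarith
        moreover have "card (X1 \<inter> X2) \<le> card (A \<inter> B)"
          using AB finA by (intro card_mono) auto
        ultimately have "A = B"
          using sep[rule_format, OF AB(1,3)] by simp
        then show ?thesis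
          using 2 AB by auto
      qed simp
    qed
    show "\<G> \<subseteq> ?Q"
      using sub cov by blast
  qed
  then have all: "\<exists>A\<in>P. X \<subseteq> A" if "X \<subseteq> V" "card X = r + 1" for X
    using that by (auto simp: uniform_circuits_def)
  \<comment> \<open>As \<open>r < card V\<close>, some circuit exists, so the cover is
    nonempty.\<close>
  obtain X where "X \<subseteq> V" "card X = r + 1"
    using True obtain_subset_with_card_n[of "r + 1" V] by auto
  then obtain A where A: "A \<in> P"
    using all by blast
  have "V \<subseteq> A"
  proof
    fix x assume x: "x \<in> V"
    show "x \<in> A"
    proof (rule ccontr)
      assume xA: "x \<notin> A"
      \<comment> \<open>Adding \<open>x\<close> to \<open>r\<close> points of \<open>A\<close> gives
        a circuit; the cover set containing it shares those points with \<open>A\<close>, hence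
        equals \<open>A\<close>, although \<open>x\<close> is outside \<open>A\<close>.\<close>
      obtain T where T: "T \<subseteq> A" "card T = r"
        using big[OF A] obtain_subset_with_card_n[of r A] by auto
      have "finite T"
        using T finA[OF A] finite_subset by blast
      moreover have "x \<notin> T"
        using T xA by blast
      moreover have "insert x T \<subseteq> V"
        using T(1) x PV[OF A] \<G>V by blast
      ultimately obtain B where B: "B \<in> P" "insert x T \<subseteq> B"
        using all[of "insert x T"] T(2) by auto
      have "card T \<le> card (A \<inter> B)"
        using T B finA[OF A] by (intro card_mono) auto
      then have "A = B"
        using sep[rule_format, OF A B(1)] T(2) by simp
      with B xA show False by simp
    qed
  qed
  \<comment> \<open>This one set already carries the whole required weight.\<close>
  then have "card V - r \<le> card A - r"
    using finA[OF A] by (simp add: card_mono diff_le_mono)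
  also have "\<dots> \<le> (\<Sum>A\<in>P. card A - r)"
    using member_le_sum[of A P "\<lambda>A. card A - r"] A finP by simp
  finally show ?thesis
    using sum by linarith
qed simp

theorem theorem19:
  fixes V :: "'a set" and r :: nat
  assumes "finite V" and "r \<ge> 1" and "r \<le> card V"
  shows "(\<exists>\<G>. generator (uniform_circuits V r) \<G> \<and> card \<G> = card V - r) \<and>
         (\<forall>\<G>. generator (uniform_circuits V r) \<G> \<longrightarrow> card V - r \<le> card \<G>)"
proof (intro conjI)
  \<comment> \<open>If \<open>card V = r\<close>, then \<open>S = V\<close> and the star is empty,
    as is the family of circuits.\<close>
  obtain S where S: "S \<subseteq> V" "card S = r" "finite S"
    using obtain_subset_with_card_n[OF assms(3)] by blast
  have "inj_on (\<lambda>x. insert x S) (V - S)"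
    by (auto simp: inj_on_def)
  then have "card ((\<lambda>x. insert x S) ` (V - S)) = card V - r"
    using S by (simp add: card_image card_Diff_subset)
  then show "\<exists>\<G>. generator (uniform_circuits V r) \<G> \<and> card \<G> = card V - r"
    using star_generates_uniform_circuits[OF assms(1) S(1,2)] by blast
  show "\<forall>\<G>. generator (uniform_circuits V r) \<G> \<longrightarrow> card V - r \<le> card \<G>"
    using generator_uniform_circuits_card_ge[OF assms(1)] by blast
qed

end
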